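(* Let $\mathbb{V}$ be an $n$-dimensional vector space ($n\ge 1$) over a finite field $\mathbb{F}$ with $q$ elements, and let $\Gamma(\mathbb{V})$ be its non-zero component graph. If $q\geq 3$, then the exchange property holds in the graph $\Gamma(\mathbb{V})$.
   Context: The non-zero component graph $\Gamma(\mathbb{V})$ with respect to a basis $\{\alpha_1,\ldots,\alpha_n\}$ of $\mathbb{V}$ is the simple graph whose vertices are the non-zero vectors of $\mathbb{V}$; two distinct vertices are joined by an edge if there is at least one $\alpha_i$ having non-zero coefficient in the basis expansions of both of them (up to isomorphism the graph does not depend on the basis). In a finite simple connected graph $\Gamma$, $d(u,v)$ is the length of a shortest path between $u$ and $v$. A set $W=\{w_1,\ldots,w_k\}$ of vertices is a resolving set if distinct vertices $v$ of $\Gamma$ have distinct representations $r(v|W)=(d(v,w_1),\ldots,d(v,w_k))$. A resolving set $W$ of cardinality $k$ is minimal if it does not contain a resolving set of cardinality $k-1$ as a proper subset. The exchange property (for resolving sets) holds in $\Gamma$ if whenever $W_1$ and $W_2$ are minimal resolving sets for $\Gamma$ and $r\in W_1$, there exists $s\in W_2$ such that $(W_2\setminus\{s\})\cup\{r\}$ is also a minimal resolving set. *)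

theory Defs
  imports "Graph_Theory.Graph_Theory"
begin

text \<open>
  A simple graph is a loop-free symmetric digraph: each edge is present as two opposite arcs.
\<close>

definition nonzero_component_graph ::
  "('f::field \<Rightarrow> 'v::ab_group_add \<Rightarrow> 'v) \<Rightarrow> 'v set \<Rightarrow> 'v pair_pre_digraph" where
  "nonzero_component_graph scale B =
    \<lparr> pverts = {v. v \<noteq> 0},
      parcs = {(u, v). u \<noteq> 0 \<and> v \<noteq> 0 \<and> u \<noteq> v \<and>
        (\<exists>b\<in>B. module.representation scale B u b \<noteq> 0 \<and>
               module.representation scale B v b \<noteq> 0)} \<rparr>"

text \<open>Only meaningful if there is a path from \<open>u\<close> to \<open>v\<close>, as in a connected graph.\<close>

definition graph_dist :: "'a pair_pre_digraph \<Rightarrow> 'a \<Rightarrow> 'a \<Rightarrow> nat" where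
  "graph_dist G u v = (LEAST k. \<exists>p. pre_digraph.apath (with_proj G) u p v \<and> length p = k)"

text \<open>
  The tuple \<open>r(v|W)\<close>, indexed by the elements of \<open>W\<close> instead of an enumeration of them.
\<close>

definition metric_rep :: "'a pair_pre_digraph \<Rightarrow> 'a set \<Rightarrow> 'a \<Rightarrow> 'a \<Rightarrow> nat" where
  "metric_rep G W v = restrict (graph_dist G v) W"

definition resolving_set :: "'a pair_pre_digraph \<Rightarrow> 'a set \<Rightarrow> bool" where
  "resolving_set G W \<longleftrightarrow>
    finite W \<and> W \<subseteq> pverts G \<and>
    (\<forall>u\<in>pverts G. \<forall>v\<in>pverts G. u \<noteq> v \<longrightarrow> metric_rep G W u \<noteq> metric_rep G W v)"

definition minimal_resolving_set :: "'a pair_pre_digraph \<Rightarrow> 'a set \<Rightarrow> bool" where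
  "minimal_resolving_set G W \<longleftrightarrow>
    resolving_set G W \<and>
    \<not> (\<exists>W'. W' \<subset> W \<and> Suc (card W') = card W \<and> resolving_set G W')"

definition exchange_property :: "'a pair_pre_digraph \<Rightarrow> bool" where
  "exchange_property G \<longleftrightarrow>
    (\<forall>W1 W2 r. minimal_resolving_set G W1 \<and> minimal_resolving_set G W2 \<and> r \<in> W1 \<longrightarrow>
      (\<exists>s\<in>W2. minimal_resolving_set G ((W2 - {s}) \<union> {r})))"

end

theory Submission
  imports Defs
begin

text \<open>
  Call two vertices equivalent if their basis expansions have the same support. Equivalent vertices
  are twins, so a resolving set omits at most one vertex of each class. Over a field with at least
  three elements every class has at least two vertices, so such a set meets every class, in
  particular the classes of the basis vectors, and these already separate different supports. Hence
  the minimal resolving sets are exactly the complements of transversals of the classes, and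
  exchange is possible within the class of the new vertex.
\<close>

section \<open>Exchange from a description of resolving sets by classes\<close>

text \<open>Minimality only concerns deletions of a single vertex \<open>w\<close>, and such a
  deletion stays resolving exactly when \<open>W\<close> contains the whole class of
  \<open>w\<close>.\<close>

lemma minimal_resolving_set_iff_classes:
  fixes c :: "'a \<Rightarrow> 'b"
  assumes res: "\<And>W. resolving_set G W \<longleftrightarrow> finite W \<and> W \<subseteq> pverts G \<and>
      (\<forall>u\<in>pverts G. \<forall>v\<in>pverts G. u \<noteq> v \<longrightarrow> c u = c v \<longrightarrow> u \<in> W \<or> v \<in> W)"
  shows "minimal_resolving_set G W \<longleftrightarrow>
    resolving_set G W \<and> (\<forall>w\<in>W. \<exists>u\<in>pverts G - W. c u = c w)"
proof (cases "resolving_set G W")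
  case True
  then have fin: "finite W" and sub: "W \<subseteq> pverts G"
    and cov: "\<And>u v. \<lbrakk>u \<in> pverts G; v \<in> pverts G; u \<noteq> v; c u = c v\<rbrakk> \<Longrightarrow> u \<in> W \<or> v \<in> W"
    by (auto simp: res)
  have del: "resolving_set G (W - {w}) \<longleftrightarrow> \<not> (\<exists>u\<in>pverts G - W. c u = c w)" if w: "w \<in> W" for w
  proof
    assume "resolving_set G (W - {w})"
    with w sub show "\<not> (\<exists>u\<in>pverts G - W. c u = c w)"
      by (fastforce simp: res)
  next
    assume no: "\<not> (\<exists>u\<in>pverts G - W. c u = c w)"
    \<comment> \<open>Only a pair containing \<open>w\<close> is critical; its other member lies in
      \<open>W\<close> by \<open>no\<close>.\<close>
    have "u \<in> W - {w} \<or> v \<in> W - {w}"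
      if "u \<in> pverts G" "v \<in> pverts G" "u \<noteq> v" "c u = c v" for u v
      using cov[OF that] that no by (metis DiffI singletonD)
    with fin sub show "resolving_set G (W - {w})"
      unfolding res by blast
  qed
  have "(\<exists>W'. W' \<subset> W \<and> Suc (card W') = card W \<and> resolving_set G W') \<longleftrightarrow>
      (\<exists>w\<in>W. resolving_set G (W - {w}))" (is "?L \<longleftrightarrow> ?R")
  proof
    assume ?L
    then obtain W' where W': "W' \<subset> W" "Suc (card W') = card W" "resolving_set G W'"
      by blast
    then have "card (W - W') = 1"
      using fin card_Diff_subset[of W' W] finite_subset[of W' W] by auto
    then obtain w where "W - W' = {w}"
      by (auto simp: card_1_singleton_iff)
    with W' have "w \<in> W" "W' = W - {w}"
      by auto
    with W' show ?R
      by blast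
  next
    assume ?R
    with fin show ?L
      by (metis Diff_subset card_Suc_Diff1 n_not_Suc_n psubsetI)
  qed
  with True del show ?thesis
    unfolding minimal_resolving_set_def by blast
qed (simp add: minimal_resolving_set_def)

text \<open>If \<open>r\<close> is not in \<open>W2\<close>, it is the only vertex of its class that
  \<open>W2\<close> omits. Any twin \<open>s\<close> of \<open>r\<close> is therefore in
  \<open>W2\<close>, and the swap merely changes which vertex of this class is omitted.\<close>

lemma exchange_property_if_classes:
  fixes c :: "'a \<Rightarrow> 'b"
  assumes res: "\<And>W. resolving_set G W \<longleftrightarrow> finite W \<and> W \<subseteq> pverts G \<and>
      (\<forall>u\<in>pverts G. \<forall>v\<in>pverts G. u \<noteq> v \<longrightarrow> c u = c v \<longrightarrow> u \<in> W \<or> v \<in> W)"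
    and twin: "\<And>v. v \<in> pverts G \<Longrightarrow> \<exists>u\<in>pverts G. u \<noteq> v \<and> c u = c v"
  shows "exchange_property G"
  unfolding exchange_property_def
proof (intro allI impI, elim conjE)
  fix W1 W2 r
  assume W1: "minimal_resolving_set G W1" and W2: "minimal_resolving_set G W2" and r: "r \<in> W1"
  note min_iff = minimal_resolving_set_iff_classes[OF res]
  show "\<exists>s\<in>W2. minimal_resolving_set G (W2 - {s} \<union> {r})"
  proof (cases "r \<in> W2")
    case True
    then show ?thesis
      using W2 by (intro bexI[of _ r]) (auto simp: insert_absorb)
  next
    case False
    have rV: "r \<in> pverts G"
      using W1 r by (auto simp: min_iff res)
    have fin: "finite W2" and sub: "W2 \<subseteq> pverts G"
      and cov: "\<And>u v. \<lbrakk>u \<in> pverts G; v \<in> pverts G; u \<noteq> v; c u = c v\<rbrakk> \<Longrightarrow> u \<in> W2 \<or> v \<in> W2"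
      and omit: "\<And>w. w \<in> W2 \<Longrightarrow> \<exists>u\<in>pverts G - W2. c u = c w"
      using W2 by (auto simp: min_iff res)
    obtain s where s: "s \<in> pverts G" "s \<noteq> r" "c s = c r"
      using twin[OF rV] by blast
    then have sW: "s \<in> W2"
      using cov[OF s(1) rV] False by blast
    let ?W = "W2 - {s} \<union> {r}"
    have "u \<in> ?W \<or> v \<in> ?W" if "u \<in> pverts G" "v \<in> pverts G" "u \<noteq> v" "c u = c v" for u v
      using cov[OF that] cov[OF that(1) rV] cov[OF that(2) rV] that s False by auto
    moreover have "\<exists>u\<in>pverts G - ?W. c u = c w" if w: "w \<in> ?W" for w
    \<comment> \<open>In the class of \<open>r\<close> the omitted vertex is now \<open>s\<close>;
      every other class keeps the one omitted by \<open>W2\<close>.\<close>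
    proof (cases "c w = c r")
      case True
      then show ?thesis
        using s by auto
    next
      case False
      with w s have "w \<in> W2"
        by auto
      then obtain u where "u \<in> pverts G - W2" "c u = c w"
        using omit by blast
      with False show ?thesis
        by (intro bexI[of _ u]) auto
    qed
    ultimately have "minimal_resolving_set G ?W"
      using fin sub rV unfolding min_iff res by blast
    with sW show ?thesis
      by blast
  qed
qed

section \<open>Distances 0, 1 and 2 in an arbitrary graph\<close>

lemma graph_dist_self: "u \<in> pverts G \<Longrightarrow> graph_dist G u u = 0"
  unfolding graph_dist_def pre_digraph.apath_def pre_digraph.awalk_def
  by (rule Least_equality) (auto intro!: exI[of _ "[]"] simp: pre_digraph.cas.simps pre_digraph.awalk_verts.simps)

lemma graph_dist_eq_1:
  assumes "u \<in> pverts G" "u \<noteq> v" "(u, v) \<in> parcs G"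
  shows "graph_dist G u v = 1"
  unfolding graph_dist_def
proof (rule Least_equality)
  show "\<exists>p. pre_digraph.apath (with_proj G) u p v \<and> length p = 1"
    using assms by (intro exI[of _ "[(u, v)]"])
      (auto simp: pre_digraph.apath_def pre_digraph.awalk_def pre_digraph.cas.simps
        pre_digraph.awalk_verts.simps)
next
  fix k assume "\<exists>p. pre_digraph.apath (with_proj G) u p v \<and> length p = k"
  then show "1 \<le> k"
    using assms by (cases k)
      (auto simp: pre_digraph.apath_def pre_digraph.awalk_def pre_digraph.cas.simps)
qed

lemma graph_dist_eq_2:
  assumes "u \<in> pverts G" "u \<noteq> v" "(u, v) \<notin> parcs G"
    and "(u, w) \<in> parcs G" "(w, v) \<in> parcs G" "w \<noteq> u" "w \<noteq> v"
  shows "graph_dist G u v = 2"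
  unfolding graph_dist_def
proof (rule Least_equality)
  show "\<exists>p. pre_digraph.apath (with_proj G) u p v \<and> length p = 2"
    using assms by (intro exI[of _ "[(u, w), (w, v)]"])
      (auto simp: pre_digraph.apath_def pre_digraph.awalk_def pre_digraph.cas.simps
        pre_digraph.awalk_verts.simps)
next
  fix k assume "\<exists>p. pre_digraph.apath (with_proj G) u p v \<and> length p = k"
  then obtain p where p: "pre_digraph.awalk (with_proj G) u p v" "length p = k"
    by (auto simp: pre_digraph.apath_def)
  have "k \<noteq> 0" "k \<noteq> 1"
    using p assms
    by (auto simp: pre_digraph.awalk_def pre_digraph.cas.simps length_Suc_conv)
  then show "2 \<le> k"
    by simp
qed

section \<open>Supports of basis expansions\<close>

context vector_space
begin

definition support :: "'b set \<Rightarrow> 'b \<Rightarrow> 'b set" where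
  "support B v = {b \<in> B. representation B v b \<noteq> 0}"

end

context finite_dimensional_vector_space
begin

lemma support_eq_empty_iff: "support Basis v = {} \<longleftrightarrow> v = 0"
proof
  assume "support Basis v = {}"
  then have "(\<Sum>b\<in>Basis. representation Basis v b *s b) = 0"
    by (intro sum.neutral) (auto simp: support_def)
  then show "v = 0"
    using sum_representation_eq[OF independent_Basis, of v Basis] finite_Basis span_Basis
    by simp
qed (simp add: support_def representation_zero)

lemma support_Basis: "b \<in> Basis \<Longrightarrow> support Basis b = {b}"
  by (auto simp: support_def representation_basis[OF independent_Basis] split: if_splits)

lemma support_scale: "a \<noteq> 0 \<Longrightarrow> support Basis (a *s v) = support Basis v"
  by (simp add: support_def representation_scale[OF independent_Basis] span_Basis)

text \<open>No basis vector has non-zero coefficients in both summands, so nothing cancels. This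
  makes \<open>u + v\<close> a common neighbour of non-zero vectors with disjoint supports.\<close>

lemma support_add_disjoint:
  "support Basis u \<inter> support Basis v = {} \<Longrightarrow>
    support Basis (u + v) = support Basis u \<union> support Basis v"
  by (auto simp: support_def representation_add[OF independent_Basis] span_Basis)

section \<open>Distances and resolving sets in the component graph\<close>

lemma pverts_nonzero_component_graph:
  "pverts (nonzero_component_graph scale Basis) = {v. v \<noteq> 0}"
  by (simp add: nonzero_component_graph_def)

text \<open>The conditions that \<open>u\<close> and \<open>v\<close> are non-zero are absorbed: the
  zero vector has empty support.\<close>

lemma arc_nonzero_component_graph_iff:
  "(u, v) \<in> parcs (nonzero_component_graph scale Basis) \<longleftrightarrow>
    u \<noteq> v \<and> support Basis u \<inter> support Basis v \<noteq> {}"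
  using support_eq_empty_iff[of u] support_eq_empty_iff[of v]
  by (auto simp: nonzero_component_graph_def support_def)

text \<open>Vertices with disjoint supports are joined through \<open>u + v\<close>. Apart from the
  case \<open>u = v\<close>, the distance thus depends on the supports alone, which makes vertices
  of equal support twins.\<close>

lemma graph_dist_nonzero_component_graph:
  assumes "u \<noteq> 0" "v \<noteq> 0"
  shows "graph_dist (nonzero_component_graph scale Basis) u v =
    (if u = v then 0 else if support Basis u \<inter> support Basis v \<noteq> {} then 1 else 2)"
proof -
  let ?G = "nonzero_component_graph scale Basis"
  have "graph_dist ?G u v = 2" if disj: "support Basis u \<inter> support Basis v = {}"
  proof (rule graph_dist_eq_2[where w = "u + v"])
    show "(u, u + v) \<in> parcs ?G" "(u + v, v) \<in> parcs ?G"
      using assms disj support_eq_empty_iff[of u] support_eq_empty_iff[of v]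
      by (auto simp: arc_nonzero_component_graph_iff support_add_disjoint)
    show "u \<noteq> v"
      using assms disj support_eq_empty_iff[of u] by auto
  qed (use assms disj in \<open>auto simp: arc_nonzero_component_graph_iff pverts_nonzero_component_graph\<close>)
  then show ?thesis
    using assms
    by (auto simp: graph_dist_self graph_dist_eq_1 arc_nonzero_component_graph_iff
        pverts_nonzero_component_graph)
qed

text \<open>The twin is the multiple \<open>a *s v\<close>; a scalar other than 0 and 1 exists
  because the field has at least three elements.\<close>

lemma exists_twin:
  fixes a :: 'a and v :: 'b
  assumes a: "a \<noteq> 0" "a \<noteq> 1" and v: "v \<noteq> 0"
  shows "\<exists>u. u \<noteq> 0 \<and> u \<noteq> v \<and> support Basis u = support Basis v"
proof (intro exI conjI)
  show "a *s v \<noteq> v"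
    using a v by (metis scale_one scale_right_imp_eq)
qed (use a v in \<open>simp_all add: support_scale\<close>)

lemma resolving_set_nonzero_component_graph_iff:
  fixes a :: 'a
  assumes a: "a \<noteq> 0" "a \<noteq> 1"
  shows "resolving_set (nonzero_component_graph scale Basis) W \<longleftrightarrow> finite W \<and> W \<subseteq> {v. v \<noteq> 0} \<and>
    (\<forall>u v. u \<noteq> 0 \<longrightarrow> v \<noteq> 0 \<longrightarrow> u \<noteq> v \<longrightarrow> support Basis u = support Basis v \<longrightarrow> u \<in> W \<or> v \<in> W)"
    (is "?L \<longleftrightarrow> ?R")
proof
  let ?G = "nonzero_component_graph scale Basis"
  assume L: ?L
  have "u \<in> W \<or> v \<in> W"
    if uv: "u \<noteq> 0" "v \<noteq> 0" "u \<noteq> v" and eq: "support Basis u = support Basis v" for u v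
  proof (rule ccontr)
    assume "\<not> (u \<in> W \<or> v \<in> W)"
    moreover have "W \<subseteq> {v. v \<noteq> 0}"
      using L by (simp add: resolving_set_def pverts_nonzero_component_graph)
    \<comment> \<open>Neither vertex is in \<open>W\<close>, so the distance 0 never occurs and only
      the common support matters.\<close>
    ultimately have "metric_rep ?G W u = metric_rep ?G W v"
      unfolding metric_rep_def using uv eq
      by (intro restrict_ext) (auto simp: graph_dist_nonzero_component_graph)
    with L uv show False
      by (simp add: resolving_set_def pverts_nonzero_component_graph)
  qed
  with L show ?R
    by (simp add: resolving_set_def pverts_nonzero_component_graph)
next
  let ?G = "nonzero_component_graph scale Basis"
  assume R: ?R
  have sep: "metric_rep ?G W u \<noteq> metric_rep ?G W v"
    if uv: "u \<noteq> 0" "v \<noteq> 0" and b: "b \<in> support Basis u" "b \<notin> support Basis v" for u v b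
  proof -
    have bB: "b \<in> Basis" and "b \<noteq> 0"
      using b dependent_zero independent_Basis by (auto simp: support_def)
    \<comment> \<open>The set \<open>W\<close> may omit \<open>b\<close>, but not both
      \<open>b\<close> and its twin, so \<open>w\<close> is one of these two. Its distance to
      \<open>u\<close> is at most 1, and its distance to \<open>v\<close> is 2.\<close>
    then obtain w where w: "w \<in> W" "w \<noteq> 0" "support Basis w = {b}"
      using R exists_twin[OF a, of b] support_Basis[OF bB] by metis
    then have "graph_dist ?G u w \<noteq> graph_dist ?G v w"
      using uv b by (auto simp: graph_dist_nonzero_component_graph)
    with w show ?thesis
      unfolding metric_rep_def by (metis restrict_apply')
  qed
  have "metric_rep ?G W u \<noteq> metric_rep ?G W v" if uv: "u \<noteq> 0" "v \<noteq> 0" "u \<noteq> v" for u v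
  proof (cases "support Basis u = support Basis v")
    case True
    then have "u \<in> W \<or> v \<in> W"
      using R uv by blast
    \<comment> \<open>Whichever of the twins lies in \<open>W\<close> separates the pair, being at
      distance 0 from itself only.\<close>
    moreover have "graph_dist ?G u u \<noteq> graph_dist ?G v u" "graph_dist ?G u v \<noteq> graph_dist ?G v v"
      using uv by (simp_all add: graph_dist_nonzero_component_graph)
    ultimately show ?thesis
      unfolding metric_rep_def by (metis restrict_apply')
  next
    case False
    then show ?thesis
      \<comment> \<open>One of the two inclusions between the supports fails, hence both orders of
        the pair.\<close>
      using sep[OF uv(1,2)] sep[OF uv(2,1)] by (metis subsetI subset_antisym)
  qed
  with R show ?L
    by (auto simp: resolving_set_def pverts_nonzero_component_graph)
qed

end

theorem theorem3p6:
  fixes scale :: "'f::{field,finite} \<Rightarrow> 'v::ab_group_add \<Rightarrow> 'v"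
    and B :: "'v set" and n q :: nat
  assumes "finite_dimensional_vector_space scale B"
    and "vector_space.dim scale (UNIV :: 'v set) = n" and "n \<ge> 1"
    and "card (UNIV :: 'f set) = q" and "q \<ge> 3"
  shows "exchange_property (nonzero_component_graph scale B)"
proof -
  interpret finite_dimensional_vector_space scale B
    by fact
  have "\<not> (UNIV :: 'f set) \<subseteq> {0, 1}"
    using assms(4,5) card_mono[of "{0, 1 :: 'f}" UNIV] by auto
  then obtain a :: 'f where a: "a \<noteq> 0" "a \<noteq> 1"
    by auto
  show ?thesis
  proof (rule exchange_property_if_classes[where c = "support B"])
    fix v
    assume "v \<in> pverts (nonzero_component_graph scale B)"
    then show "\<exists>u\<in>pverts (nonzero_component_graph scale B). u \<noteq> v \<and> support B u = support B v"
      using exists_twin[OF a, of v] by (auto simp: pverts_nonzero_component_graph)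
  qed (simp add: resolving_set_nonzero_component_graph_iff[OF a] pverts_nonzero_component_graph)
qed

end
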